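(* Let $n\geq 4$ be an integer and let $\mathcal{R}_n\subseteq M_n(\mathbb{F}_2)$ be the ring defined in the context. Then $\mathcal{N}(\mathcal{R}_n)$ is not a two-sided ideal of $\mathcal{R}_n[x]$.
   Context: For a finite associative unital ring $R$, $R[x]$ is the ring of polynomials over $R$ in a central indeterminate $x$. Polynomials satisfy right evaluation: for $f(x)=\sum_i c_i x^i$ (coefficients on the left) and $a\in R$, $f(a)=\sum_i c_i a^i$. The null ideal is $\mathcal{N}(R)=\{f\in R[x] \mid f(a)=0 \text{ for all } a\in R\}$. For $n\geq 4$, the subring $\mathcal{R}_n$ of $M_n(\mathbb{F}_2)$ is defined as follows. If $n$ is even, $\mathcal{R}_n$ consists of all matrices which, viewed as $(n/2)\times(n/2)$ block matrices with $2\times 2$ blocks, have all blocks below the diagonal equal to $0$, all diagonal blocks equal to one and the same matrix $\begin{pmatrix} a & b\\ 0 & c\end{pmatrix}$ with $a,b,c\in\mathbb{F}_2$, and arbitrary blocks above the diagonal. If $n=2k+1$ is odd ($k\geq 2$), $\mathcal{R}_n$ consists of all matrices $\begin{pmatrix} A & v\\ 0 & c\end{pmatrix}$ where $A\in\mathcal{R}_{2k}$, $v$ is an arbitrary $2k\times 1$ column over $\mathbb{F}_2$, and $c$ is the $(2k,2k)$-entry of $A$. *)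

theory Defs
  imports
    "HOL-Algebra.UnivPoly"
    "HOL-Algebra.Subrings"
    "HOL-Library.Z2"
    "Jordan_Normal_Form.Matrix"
begin

text \<open>
  The polynomial ring \<^term>\<open>UP R\<close> only needs \<open>R\<close> to be a ring, and its indeterminate is
  central.  In \<^const>\<open>eval\<close> the coefficients stand to the left of the powers of the argument,
  so with the identity as coefficient map it is right evaluation.
\<close>

definition null_ideal :: "('a, 'm) ring_scheme \<Rightarrow> (nat \<Rightarrow> 'a) set" where
  "null_ideal R =
    {f \<in> carrier (UP R). \<forall>a \<in> carrier R. eval R R id a f = \<zero>\<^bsub>R\<^esub>}"

text \<open>All matrix, block and row/column indices start at \<open>0\<close>; \<^typ>\<open>bit\<close> is the field with two
  elements.\<close>

definition block2 :: "'a mat \<Rightarrow> nat \<Rightarrow> nat \<Rightarrow> 'a mat" where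
  "block2 M i j = mat 2 2 (\<lambda>(r, s). M $$ (2 * i + r, 2 * j + s))"

definition Rn_even :: "nat \<Rightarrow> bit mat set" where
  "Rn_even k = {M \<in> carrier_mat (2 * k) (2 * k).
     (\<forall>i<k. \<forall>j<i. block2 M i j = 0\<^sub>m 2 2) \<and>
     (\<exists>a b c. \<forall>i<k. block2 M i i = mat_of_rows_list 2 [[a, b], [0, c]])}"

text \<open>The \<open>(2k, 2k)\<close>-entry in one-based numbering is the entry \<open>(2k - 1, 2k - 1)\<close> here.\<close>

definition Rn_odd :: "nat \<Rightarrow> bit mat set" where
  "Rn_odd k =
    {four_block_mat A v (0\<^sub>m 1 (2 * k)) (mat_of_rows_list 1 [[A $$ (2 * k - 1, 2 * k - 1)]]) | A v.
       A \<in> Rn_even k \<and> v \<in> carrier_mat (2 * k) 1}"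

definition Rn_set :: "nat \<Rightarrow> bit mat set" where
  "Rn_set n = (if even n then Rn_even (n div 2) else Rn_odd (n div 2))"

text \<open>The definition is intended for \<open>n \<ge> 4\<close> only.\<close>

definition Rn :: "nat \<Rightarrow> bit mat ring" where
  "Rn n = ring_mat TYPE(bit) n () \<lparr>carrier := Rn_set n\<rparr>"

text \<open>
  The locale \<^const>\<open>ideal\<close> includes the ring axioms, so that a failure of \<^const>\<open>ideal\<close> is
  only meaningful in a ring; the rest of this theory shows that \<open>Rn_set n\<close> is a (unital) subring
  of the matrix ring and hence that \<open>UP (Rn n)\<close> is a ring.
\<close>

lemma block2_index:
  "r < 2 \<Longrightarrow> s < 2 \<Longrightarrow> block2 M i j $$ (r, s) = M $$ (2 * i + r, 2 * j + s)"
  by (simp add: block2_def)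

lemma block2_eq_iff:
  assumes "B \<in> carrier_mat 2 2"
  shows "block2 M i j = B \<longleftrightarrow>
    M $$ (2 * i, 2 * j) = B $$ (0, 0) \<and> M $$ (2 * i, Suc (2 * j)) = B $$ (0, 1) \<and>
    M $$ (Suc (2 * i), 2 * j) = B $$ (1, 0) \<and> M $$ (Suc (2 * i), Suc (2 * j)) = B $$ (1, 1)"
  using assms by (auto simp: block2_def mat_eq_iff less_2_cases_iff)

definition diag_repr :: "nat \<Rightarrow> nat \<Rightarrow> nat" where
  "diag_repr n i = (if odd i \<or> Suc i = n then 1 else 0)"

definition Rn_entries :: "nat \<Rightarrow> bit mat \<Rightarrow> bool" where
  "Rn_entries n M \<longleftrightarrow> M \<in> carrier_mat n n \<and>
     (\<forall>i<n. \<forall>j<i. M $$ (i, j) = 0) \<and>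
     (\<forall>i<n. M $$ (i, i) = M $$ (diag_repr n i, diag_repr n i)) \<and>
     (\<forall>i. Suc (2 * i) < n \<longrightarrow> M $$ (2 * i, Suc (2 * i)) = M $$ (0, 1))"

lemma Rn_entriesD:
  assumes "Rn_entries n M"
  shows "i < n \<Longrightarrow> j < i \<Longrightarrow> M $$ (i, j) = 0"
    and "i < n \<Longrightarrow> M $$ (i, i) = M $$ (diag_repr n i, diag_repr n i)"
    and "Suc (2 * i) < n \<Longrightarrow> M $$ (2 * i, Suc (2 * i)) = M $$ (0, 1)"
  using assms unfolding Rn_entries_def by blast+

lemma Rn_even_iff:
  assumes "k \<ge> 1"
  shows "M \<in> Rn_even k \<longleftrightarrow> Rn_entries (2 * k) M"
proof -
  have carr: "mat_of_rows_list 2 [[a, b], [0, c]] \<in> carrier_mat 2 2" for a b c :: bit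
    by (auto simp: mat_of_rows_list_def)
  have entries: "block2 M i i = mat_of_rows_list 2 [[a, b], [0, c]] \<longleftrightarrow>
      M $$ (2 * i, 2 * i) = a \<and> M $$ (2 * i, Suc (2 * i)) = b \<and>
      M $$ (Suc (2 * i), 2 * i) = 0 \<and> M $$ (Suc (2 * i), Suc (2 * i)) = c" for i a b c
    unfolding block2_eq_iff[OF carr] by (simp add: mat_of_rows_list_def)
  have zero: "block2 M i j = 0\<^sub>m 2 2 \<longleftrightarrow>
      M $$ (2 * i, 2 * j) = 0 \<and> M $$ (2 * i, Suc (2 * j)) = 0 \<and>
      M $$ (Suc (2 * i), 2 * j) = 0 \<and> M $$ (Suc (2 * i), Suc (2 * j)) = 0" for i j
    by (subst block2_eq_iff) auto
  show ?thesis
  proof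
    assume M: "M \<in> Rn_even k"
    then obtain a b c where "\<forall>i<k. block2 M i i = mat_of_rows_list 2 [[a, b], [0, c]]"
      unfolding Rn_even_def by blast
    then have d: "\<And>i. i < k \<Longrightarrow> M $$ (2 * i, 2 * i) = a \<and>
        M $$ (2 * i, Suc (2 * i)) = b \<and> M $$ (Suc (2 * i), 2 * i) = 0 \<and>
        M $$ (Suc (2 * i), Suc (2 * i)) = c"
      unfolding entries by blast
    have z: "M $$ (2 * i, 2 * j) = 0 \<and> M $$ (2 * i, Suc (2 * j)) = 0 \<and>
        M $$ (Suc (2 * i), 2 * j) = 0 \<and> M $$ (Suc (2 * i), Suc (2 * j)) = 0"
      if "i < k" "j < i" for i j
    proof -
      have "block2 M i j = 0\<^sub>m 2 2" using M that unfolding Rn_even_def by blast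
      then show ?thesis unfolding zero .
    qed
    have "M $$ (i, j) = 0" if "i < 2 * k" "j < i" for i j
    proof -
      define p q where "p = i div 2" and "q = j div 2"
      have i: "i = 2 * p \<or> i = Suc (2 * p)" and j: "j = 2 * q \<or> j = Suc (2 * q)"
        unfolding p_def q_def by presburger+
      have p: "p < k" using that i by auto
      show ?thesis
      proof (cases "q < p")
        case True
        then show ?thesis using z[OF p True] i j by auto
      next
        case False
        with i j that(2) have "q = p" by arith
        with i j that(2) have "i = Suc (2 * p)" "j = 2 * p" by arith+
        then show ?thesis using d[OF p] by simp
      qed
    qed
    moreover have "M $$ (i, i) = M $$ (diag_repr (2 * k) i, diag_repr (2 * k) i)"
      if "i < 2 * k" for i
    proof (cases "even i")
      case True
      then obtain m where "i = 2 * m" by auto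
      moreover have "Suc (2 * m) \<noteq> 2 * k" by presburger
      ultimately show ?thesis using d[of m] d[of 0] assms that by (simp add: diag_repr_def)
    next
      case False
      then obtain m where "i = Suc (2 * m)" using oddE by fastforce
      then show ?thesis using d[of m] d[of 0] assms that by (simp add: diag_repr_def)
    qed
    moreover have "M $$ (2 * i, Suc (2 * i)) = M $$ (0, 1)" if "Suc (2 * i) < 2 * k" for i
      using d[of i] d[of 0] assms that by simp
    ultimately show "Rn_entries (2 * k) M"
      using M unfolding Rn_entries_def Rn_even_def by blast
  next
    assume M: "Rn_entries (2 * k) M"
    have lt: "2 * i < 2 * k" "Suc (2 * i) < 2 * k" if "i < k" for i
      using that by auto
    have rep: "diag_repr (2 * k) (2 * i) = 0" "diag_repr (2 * k) (Suc (2 * i)) = 1" for i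
    proof -
      have "Suc (2 * i) \<noteq> 2 * k" by presburger
      then show "diag_repr (2 * k) (2 * i) = 0" "diag_repr (2 * k) (Suc (2 * i)) = 1"
        by (simp_all add: diag_repr_def)
    qed
    have up: "M $$ (i, j) = 0" if "i < 2 * k" "j < i" for i j
      using M that unfolding Rn_entries_def by blast
    have di: "M $$ (i, i) = M $$ (diag_repr (2 * k) i, diag_repr (2 * k) i)" if "i < 2 * k" for i
      using M that unfolding Rn_entries_def by blast
    have su: "M $$ (2 * i, Suc (2 * i)) = M $$ (0, 1)" if "Suc (2 * i) < 2 * k" for i
      using M that unfolding Rn_entries_def by blast
    have "M $$ (2 * i, 2 * i) = M $$ (0, 0)" "M $$ (Suc (2 * i), Suc (2 * i)) = M $$ (1, 1)"
      if "i < k" for i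
      using di[OF lt(1)[OF that]] di[OF lt(2)[OF that]] rep by simp_all
    then have "\<forall>i<k. block2 M i i =
        mat_of_rows_list 2 [[M $$ (0, 0), M $$ (0, 1)], [0, M $$ (1, 1)]]"
      unfolding entries using su up lt by simp
    moreover have "\<forall>i<k. \<forall>j<i. block2 M i j = 0\<^sub>m 2 2"
      unfolding zero by (auto intro!: up)
    ultimately show "M \<in> Rn_even k"
      using M unfolding Rn_even_def Rn_entries_def by blast
  qed
qed

lemma Rn_odd_iff:
  assumes "k \<ge> 1"
  shows "M \<in> Rn_odd k \<longleftrightarrow> Rn_entries (Suc (2 * k)) M"
proof -
  have rep: "diag_repr (Suc (2 * k)) i = diag_repr (2 * k) i" if "i < 2 * k" for i
  proof -
    from that have "Suc i \<noteq> Suc (2 * k)" by simp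
    moreover have "Suc i = 2 * k \<Longrightarrow> odd i" by presburger
    ultimately show ?thesis by (auto simp: diag_repr_def)
  qed
  have rep_lt: "diag_repr (2 * k) i < 2 * k" for i
    using assms by (simp add: diag_repr_def)
  have repl: "diag_repr (2 * k) (2 * k - 1) = 1" "diag_repr (Suc (2 * k)) (2 * k) = 1"
    using assms by (simp_all add: diag_repr_def)
  show ?thesis
  proof
    assume "M \<in> Rn_odd k"
    then obtain A v where A: "A \<in> Rn_even k" and v: "v \<in> carrier_mat (2 * k) 1"
      and M: "M = four_block_mat A v (0\<^sub>m 1 (2 * k))
        (mat_of_rows_list 1 [[A $$ (2 * k - 1, 2 * k - 1)]])"
      unfolding Rn_odd_def by blast
    have E: "Rn_entries (2 * k) A" using A Rn_even_iff assms by blast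
    then have cA: "A \<in> carrier_mat (2 * k) (2 * k)" by (simp add: Rn_entries_def)
    have cM: "M \<in> carrier_mat (Suc (2 * k)) (Suc (2 * k))"
      using four_block_carrier_mat[OF cA, of "mat_of_rows_list 1 [[A $$ (2 * k - 1, 2 * k - 1)]]" 1 1]
      by (simp add: M mat_of_rows_list_def)
    have MA: "M $$ (i, j) = A $$ (i, j)" if "i < 2 * k" "j < 2 * k" for i j
      using that cA v by (auto simp: M mat_of_rows_list_def)
    have M0: "M $$ (2 * k, j) = 0" if "j < 2 * k" for j
      using that cA v by (auto simp: M mat_of_rows_list_def)
    have "M $$ (2 * k, 2 * k) = A $$ (2 * k - 1, 2 * k - 1)"
      using cA v by (auto simp: M mat_of_rows_list_def)
    also have "\<dots> = A $$ (1, 1)"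
      using Rn_entriesD(2)[OF E, of "2 * k - 1"] assms repl by simp
    finally have Mc: "M $$ (2 * k, 2 * k) = M $$ (1, 1)" using MA assms by simp
    have "M $$ (i, j) = 0" if "i < Suc (2 * k)" "j < i" for i j
    proof (cases "i = 2 * k")
      case True
      then show ?thesis using M0 that by simp
    next
      case False
      then show ?thesis using MA[of i j] Rn_entriesD(1)[OF E, of i j] that by simp
    qed
    moreover have "M $$ (i, i) = M $$ (diag_repr (Suc (2 * k)) i, diag_repr (Suc (2 * k)) i)"
      if "i < Suc (2 * k)" for i
    proof (cases "i = 2 * k")
      case True
      then show ?thesis using Mc repl by simp
    next
      case False
      with that have "i < 2 * k" by simp
      then show ?thesis using MA[of i i] MA[OF rep_lt rep_lt] Rn_entriesD(2)[OF E, of i] rep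
        by simp
    qed
    moreover have "M $$ (2 * i, Suc (2 * i)) = M $$ (0, 1)" if "Suc (2 * i) < Suc (2 * k)" for i
    proof -
      have "Suc (2 * i) < 2 * k" "2 * i < 2 * k" using that by auto
      then show ?thesis
        using MA[of "2 * i" "Suc (2 * i)"] MA[of 0 1] Rn_entriesD(3)[OF E, of i] assms by simp
    qed
    ultimately show "Rn_entries (Suc (2 * k)) M"
      using cM unfolding Rn_entries_def by blast
  next
    assume E: "Rn_entries (Suc (2 * k)) M"
    define A where "A = mat (2 * k) (2 * k) (\<lambda>(i, j). M $$ (i, j))"
    define v where "v = mat (2 * k) 1 (\<lambda>(i, j). M $$ (i, 2 * k))"
    have up: "M $$ (i, j) = 0" if "i < Suc (2 * k)" "j < i" for i j
      using E that unfolding Rn_entries_def by blast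
    have di: "M $$ (i, i) = M $$ (diag_repr (Suc (2 * k)) i, diag_repr (Suc (2 * k)) i)"
      if "i < Suc (2 * k)" for i
      using E that unfolding Rn_entries_def by blast
    have su: "M $$ (2 * i, Suc (2 * i)) = M $$ (0, 1)" if "Suc (2 * i) < Suc (2 * k)" for i
      using E that unfolding Rn_entries_def by blast
    have "A $$ (i, i) = A $$ (diag_repr (2 * k) i, diag_repr (2 * k) i)" if "i < 2 * k" for i
      using that di[of i] rep[of i] rep_lt[of i] by (simp add: A_def)
    then have "Rn_entries (2 * k) A"
      using up su assms unfolding Rn_entries_def by (auto simp: A_def)
    then have A: "A \<in> Rn_even k" using Rn_even_iff assms by blast
    have "M $$ (2 * k, 2 * k) = M $$ (1, 1)" using di[of "2 * k"] repl by simp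
    moreover have "M $$ (2 * k - 1, 2 * k - 1) = M $$ (1, 1)"
      using di[of "2 * k - 1"] rep[of "2 * k - 1"] repl assms by simp
    ultimately have c: "A $$ (2 * k - 1, 2 * k - 1) = M $$ (2 * k, 2 * k)"
      using assms by (simp add: A_def)
    have cM: "M \<in> carrier_mat (Suc (2 * k)) (Suc (2 * k))"
      using E by (simp add: Rn_entries_def)
    have "M = four_block_mat A v (0\<^sub>m 1 (2 * k))
        (mat_of_rows_list 1 [[A $$ (2 * k - 1, 2 * k - 1)]])"
      unfolding c using cM up
      by (intro eq_matI) (auto simp: A_def v_def mat_of_rows_list_def less_Suc_eq)
    moreover have "v \<in> carrier_mat (2 * k) 1" by (simp add: v_def)
    ultimately show "M \<in> Rn_odd k" unfolding Rn_odd_def using A by blast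
  qed
qed

lemma Rn_set_iff:
  assumes "n \<ge> 2"
  shows "M \<in> Rn_set n \<longleftrightarrow> Rn_entries n M"
proof (cases "even n")
  case True
  then show ?thesis using Rn_even_iff[of "n div 2" M] assms by (simp add: Rn_set_def)
next
  case False
  then have "Suc (2 * (n div 2)) = n" by presburger
  then show ?thesis using Rn_odd_iff[of "n div 2" M] assms False by (simp add: Rn_set_def)
qed

lemma Rn_entries_mult:
  assumes n: "n \<ge> 2" and M: "Rn_entries n M" and N: "Rn_entries n N"
  shows "Rn_entries n (M * N)"
proof -
  have cM: "M \<in> carrier_mat n n" and cN: "N \<in> carrier_mat n n"
    using M N by (simp_all add: Rn_entries_def)
  have uM: "M $$ (i, j) = 0" if "i < n" "j < i" for i j
    using M that by (simp add: Rn_entries_def)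
  have uN: "N $$ (i, j) = 0" if "i < n" "j < i" for i j
    using N that by (simp add: Rn_entries_def)
  have prod: "(M * N) $$ (i, j) = (\<Sum>l\<in>{i..j}. M $$ (i, l) * N $$ (l, j))"
    if "i < n" "j < n" for i j
  proof -
    have "(M * N) $$ (i, j) = (\<Sum>l\<in>{0..<n}. M $$ (i, l) * N $$ (l, j))"
      using that cM cN by (auto simp: scalar_prod_def)
    also have "\<dots> = (\<Sum>l\<in>{i..j}. M $$ (i, l) * N $$ (l, j))"
      using that uM uN by (intro sum.mono_neutral_right) (auto simp: not_le)
    finally show ?thesis .
  qed
  have dg: "(M * N) $$ (i, i) = M $$ (i, i) * N $$ (i, i)" if "i < n" for i
    using prod that by simp
  have sp: "(M * N) $$ (i, Suc i) =
      M $$ (i, i) * N $$ (i, Suc i) + M $$ (i, Suc i) * N $$ (Suc i, Suc i)" if "Suc i < n" for i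
  proof -
    have "{i..Suc i} = {i, Suc i}" by auto
    then have "(M * N) $$ (i, Suc i) = (\<Sum>l\<in>{i, Suc i}. M $$ (i, l) * N $$ (l, Suc i))"
      using prod[of i "Suc i"] that by (simp only: Suc_lessD)
    also have "\<dots> = M $$ (i, i) * N $$ (i, Suc i) + M $$ (i, Suc i) * N $$ (Suc i, Suc i)"
      by (subst sum.insert)
        (simp_all only: finite.intros sum.insert sum.empty empty_iff insert_iff
          n_not_Suc_n not_False_eq_True add_0_right simp_thms)
    finally show ?thesis .
  qed
  have dr: "diag_repr n i < n" for i using n by (simp add: diag_repr_def)
  have "(M * N) $$ (i, j) = 0" if "i < n" "j < i" for i j
    using prod[of i j] that by simp
  moreover have "(M * N) $$ (i, i) = (M * N) $$ (diag_repr n i, diag_repr n i)" if "i < n" for i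
    unfolding dg[OF that] dg[OF dr] Rn_entriesD(2)[OF M that] Rn_entriesD(2)[OF N that] ..
  moreover have "(M * N) $$ (2 * i, Suc (2 * i)) = (M * N) $$ (0, 1)" if i: "Suc (2 * i) < n" for i
  proof -
    have r: "diag_repr n (2 * i) = 0" "diag_repr n (Suc (2 * i)) = 1"
      using i by (simp_all add: diag_repr_def)
    have dM: "M $$ (2 * i, 2 * i) = M $$ (0, 0)"
        "M $$ (Suc (2 * i), Suc (2 * i)) = M $$ (1, 1)"
      using Rn_entriesD(2)[OF M, of "2 * i"] Rn_entriesD(2)[OF M, of "Suc (2 * i)"] r i
      by simp_all
    have dN: "N $$ (2 * i, 2 * i) = N $$ (0, 0)"
        "N $$ (Suc (2 * i), Suc (2 * i)) = N $$ (1, 1)"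
      using Rn_entriesD(2)[OF N, of "2 * i"] Rn_entriesD(2)[OF N, of "Suc (2 * i)"] r i
      by simp_all
    have "M $$ (2 * i, Suc (2 * i)) = M $$ (0, 1)" "N $$ (2 * i, Suc (2 * i)) = N $$ (0, 1)"
      using Rn_entriesD(3)[OF M i] Rn_entriesD(3)[OF N i] .
    moreover have "(M * N) $$ (0, 1) = M $$ (0, 0) * N $$ (0, 1) + M $$ (0, 1) * N $$ (1, 1)"
      using sp[of 0] n unfolding One_nat_def by linarith
    ultimately show ?thesis unfolding sp[OF i] dM dN by (simp only:)
  qed
  moreover have "M * N \<in> carrier_mat n n" using cM cN by simp
  ultimately show ?thesis unfolding Rn_entries_def by blast
qed

lemma Rn_entries_add:
  assumes n: "n \<ge> 2" and M: "Rn_entries n M" and N: "Rn_entries n N"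
  shows "Rn_entries n (M + N)"
proof -
  have cM: "M \<in> carrier_mat n n" and cN: "N \<in> carrier_mat n n"
    using M N by (simp_all add: Rn_entries_def)
  have ad: "(M + N) $$ (i, j) = M $$ (i, j) + N $$ (i, j)" if "i < n" "j < n" for i j
    using that cM cN by simp
  have dr: "diag_repr n i < n" for i using n by (simp add: diag_repr_def)
  have "(M + N) $$ (i, j) = 0" if "i < n" "j < i" for i j
    using M N that ad[of i j] by (simp add: Rn_entries_def)
  moreover have "(M + N) $$ (i, i) = (M + N) $$ (diag_repr n i, diag_repr n i)" if "i < n" for i
    unfolding ad[OF that that] ad[OF dr dr] Rn_entriesD(2)[OF M that] Rn_entriesD(2)[OF N that] ..
  moreover have "(M + N) $$ (2 * i, Suc (2 * i)) = (M + N) $$ (0, 1)" if "Suc (2 * i) < n" for i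
  proof -
    have "M $$ (2 * i, Suc (2 * i)) = M $$ (0, 1)" "N $$ (2 * i, Suc (2 * i)) = N $$ (0, 1)"
      using Rn_entriesD(3)[OF M that] Rn_entriesD(3)[OF N that] .
    moreover have "2 * i < n" "0 < n" "1 < n" using that n by linarith+
    ultimately show ?thesis using ad[of "2 * i" "Suc (2 * i)"] ad[of 0 1] that by (simp only:)
  qed
  moreover have "M + N \<in> carrier_mat n n" using cM cN by simp
  ultimately show ?thesis unfolding Rn_entries_def by blast
qed

lemma subring_Rn_set:
  assumes "n \<ge> 2"
  shows "subring (Rn_set n) (ring_mat TYPE(bit) n ())"
proof -
  let ?R = "ring_mat TYPE(bit) n ()"
  interpret M: ring ?R by (rule ring_mat)
  have neg: "\<ominus>\<^bsub>?R\<^esub> A = A" if A: "A \<in> carrier_mat n n" for A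
  proof -
    have "A + A = 0\<^sub>m n n" using A by (intro eq_matI) auto
    then have "A \<oplus>\<^bsub>?R\<^esub> A = \<zero>\<^bsub>?R\<^esub>" by (simp add: ring_mat_simps)
    then show ?thesis using A M.minus_equality by (simp add: ring_mat_simps)
  qed
  have one: "Rn_entries n (1\<^sub>m n)"
    using assms by (auto simp: Rn_entries_def diag_repr_def)
  have sub: "A \<in> carrier_mat n n" if "A \<in> Rn_set n" for A
    using that Rn_set_iff[OF assms] by (simp add: Rn_entries_def)
  show ?thesis
  proof (rule M.subringI)
    show "Rn_set n \<subseteq> carrier ?R" using sub by (auto simp: ring_mat_simps)
    show "\<one>\<^bsub>?R\<^esub> \<in> Rn_set n" using one Rn_set_iff[OF assms] by (simp add: ring_mat_simps)
    show "\<ominus>\<^bsub>?R\<^esub> A \<in> Rn_set n" if "A \<in> Rn_set n" for A using neg sub that by simp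
    show "A \<otimes>\<^bsub>?R\<^esub> B \<in> Rn_set n" if "A \<in> Rn_set n" "B \<in> Rn_set n" for A B
      using that Rn_set_iff[OF assms] Rn_entries_mult[OF assms] by (simp add: ring_mat_simps)
    show "A \<oplus>\<^bsub>?R\<^esub> B \<in> Rn_set n" if "A \<in> Rn_set n" "B \<in> Rn_set n" for A B
      using that Rn_set_iff[OF assms] Rn_entries_add[OF assms] by (simp add: ring_mat_simps)
  qed
qed

lemma ring_Rn: "n \<ge> 2 \<Longrightarrow> ring (Rn n)"
  unfolding Rn_def by (rule ring.subring_is_ring[OF ring_mat subring_Rn_set])

lemma ring_UP_Rn: "n \<ge> 2 \<Longrightarrow> ring (UP (Rn n))"
  using UP_ring.UP_ring[OF UP_ring.intro[OF ring_Rn]] .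

end

theory Submission
  imports Defs
begin

text \<open>
  Let \<open>U\<close> and \<open>D\<close> be the elements of \<open>R = Rn n\<close> whose diagonal blocks are the matrix unit
  \<open>e\<^sub>1\<^sub>2\<close> and the idempotent \<open>e\<^sub>1\<^sub>1\<close>, with all other entries zero.  The polynomial
  \<open>f = (U + x) x\<^bsup>n - 2\<^esup> (x + 1)\<^bsup>n\<^esup>\<close> lies in the null ideal
  (\<open>null_poly_in_null_ideal\<close>), but \<open>f D\<close> does not (\<open>null_poly_mult_block_e11_notin_null_ideal\<close>).

  The factors \<open>x\<close> and \<open>x + 1\<close> have central coefficients, so right evaluation is multiplicative
  on them and \<open>f(A) = (U + A) A\<^bsup>n - 2\<^esup> (A + 1)\<^bsup>n\<^esup>\<close>.  Let \<open>a\<close>, \<open>c\<close> be the diagonal entries and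
  \<open>b\<close> the upper right entry of the common diagonal block of \<open>A\<close>.

  If \<open>a = c = 1\<close>, then \<open>A + 1\<close> is strictly upper triangular and \<open>(A + 1)\<^bsup>n\<^esup> = 0\<close>
  (\<open>Rn_entries_unipotent\<close>).  If \<open>a \<noteq> c\<close>, then \<open>A (A + 1)\<close> vanishes on the \<open>2\<close> by \<open>2\<close> diagonal blocks, so
  its power \<open>n - 2\<close> is zero (\<open>Rn_entries_mixed\<close>).

  The case \<open>a = c = 0\<close> (\<open>Rn_entries_nilpotent\<close>) uses the equality of the diagonal blocks.  Here
  \<open>A\<close> is strictly upper triangular, and the top right corner is the only place where
  \<open>U A\<^bsup>n - 2\<^esup>\<close> and \<open>A\<^bsup>n - 1\<^esup>\<close> can be nonzero.  In the former this entry is the product \<open>p\<close> of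
  all superdiagonal entries of \<open>A\<close> but the first; in the latter it is \<open>b p\<close>.  As \<open>n \<ge> 4\<close>, the entry \<open>b\<close> of the
  second block is a factor of \<open>p\<close>, and \<open>b\<^sup>2 = b\<close> gives \<open>b p = p\<close>.  The two contributions cancel
  in characteristic \<open>2\<close>.

  Finally \<open>U D = 0\<close>, so multiplication by \<open>D\<close> on the right removes one of these contributions:
  \<open>f D = D x\<^bsup>n - 1\<^esup> (x + 1)\<^bsup>n\<^esup>\<close>, whose value at the full shift matrix is the nonzero matrix
  \<open>e\<^sub>1\<^sub>n\<close>.
\<close>

section \<open>Right evaluation over a noncommutative ring\<close>

context UP_ring
begin

lemma eval_eq_finsum:
  assumes p: "p \<in> carrier P" and a: "a \<in> carrier R" and n: "deg R p \<le> n"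
  shows "eval R R id a p = (\<Oplus>i\<in>{..n}. coeff P p i \<otimes> a [^] i)"
proof -
  have "(\<Oplus>i\<in>{..n}. coeff P p i \<otimes> a [^] i)
      = (\<Oplus>i\<in>{..deg R p} \<union> {deg R p<..n}. coeff P p i \<otimes> a [^] i)"
    using n by (simp only: ivl_disj_un_one)
  also have "\<dots> = (\<Oplus>i\<in>{..deg R p}. coeff P p i \<otimes> a [^] i)"
    using p a by (simp cong: R.finsum_cong
      add: R.finsum_Un_disjoint ivl_disj_int_one deg_aboveD Pi_def)
  finally show ?thesis
    using p by (simp add: eval_def P_def)
qed

lemma eval_closed:
  assumes "p \<in> carrier P" "a \<in> carrier R"
  shows "eval R R id a p \<in> carrier R"
  unfolding eval_eq_finsum[OF assms order_refl] using assms
  by (intro R.finsum_closed) auto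

lemma eval_add:
  assumes p: "p \<in> carrier P" and q: "q \<in> carrier P" and a: "a \<in> carrier R"
  shows "eval R R id a (p \<oplus>\<^bsub>P\<^esub> q) = eval R R id a p \<oplus> eval R R id a q"
proof -
  define N where "N = max (deg R p) (deg R q)"
  have N: "deg R p \<le> N" "deg R q \<le> N" "deg R (p \<oplus>\<^bsub>P\<^esub> q) \<le> N"
    using deg_add[OF p q] by (auto simp: N_def)
  show ?thesis
    unfolding eval_eq_finsum[OF p a N(1)] eval_eq_finsum[OF q a N(2)]
      eval_eq_finsum[OF P.a_closed[OF p q] a N(3)]
    using p q a by (simp add: R.l_distr R.finsum_addf Pi_def)
qed

lemma eval_monom:
  assumes c: "c \<in> carrier R" and a: "a \<in> carrier R"
  shows "eval R R id a (monom P c k) = c \<otimes> a [^] k"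
proof -
  have "eval R R id a (monom P c k) = (\<Oplus>i\<in>{..k}. coeff P (monom P c k) i \<otimes> a [^] i)"
    by (rule eval_eq_finsum[OF monom_closed[OF c] a deg_monom_le[OF c]])
  also have "\<dots> = (\<Oplus>i\<in>{..k}. if k = i then c \<otimes> a [^] i else \<zero>)"
    using c a by (intro R.finsum_cong') auto
  also have "\<dots> = c \<otimes> a [^] k"
    using R.finsum_singleton[of k "{..k}" "\<lambda>i. c \<otimes> a [^] i"] c a by auto
  finally show ?thesis .
qed

text \<open>Right evaluation at \<open>a\<close> is not multiplicative, because \<open>a\<close> has to be moved past the
  coefficients of the right factor; when those commute with \<open>a\<close>, the product of the two sums is
  the usual Cauchy product.\<close>

lemma eval_mult_commuting:
  assumes p: "p \<in> carrier P" and q: "q \<in> carrier P" and a: "a \<in> carrier R"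
    and comm: "\<And>i. coeff P q i \<otimes> a = a \<otimes> coeff P q i"
  shows "eval R R id a (p \<otimes>\<^bsub>P\<^esub> q) = eval R R id a p \<otimes> eval R R id a q"
proof -
  let ?f = "\<lambda>i. coeff P p i \<otimes> a [^] i" and ?g = "\<lambda>i. coeff P q i \<otimes> a [^] i"
  define n m where "n = deg R p" and "m = deg R q"
  have pow: "a [^] (i::nat) \<otimes> coeff P q j = coeff P q j \<otimes> a [^] i" for i j
    using R.group_commutes_pow[OF comm[of j, symmetric]] a q by simp
  have "coeff P p i \<otimes> coeff P q (k - i) \<otimes> a [^] k = ?f i \<otimes> ?g (k - i)" if "i \<le> k" for i k
  proof -
    have "a [^] k = a [^] i \<otimes> a [^] (k - i)"
      using a that by (simp add: R.nat_pow_mult)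
    then have "coeff P p i \<otimes> coeff P q (k - i) \<otimes> a [^] k
        = coeff P p i \<otimes> (coeff P q (k - i) \<otimes> a [^] i) \<otimes> a [^] (k - i)"
      using a p q by (simp add: R.m_assoc)
    also have "\<dots> = coeff P p i \<otimes> (a [^] i \<otimes> coeff P q (k - i)) \<otimes> a [^] (k - i)"
      by (simp only: pow)
    also have "\<dots> = ?f i \<otimes> ?g (k - i)"
      using a p q by (simp add: R.m_assoc)
    finally show ?thesis .
  qed
  then have term_eq: "coeff P (p \<otimes>\<^bsub>P\<^esub> q) k \<otimes> a [^] k = (\<Oplus>i\<in>{..k}. ?f i \<otimes> ?g (k - i))" for k
    using a p q by (simp add: R.finsum_ldistr Pi_def cong: R.finsum_cong)
  have "eval R R id a (p \<otimes>\<^bsub>P\<^esub> q) = (\<Oplus>k\<in>{..n + m}. \<Oplus>i\<in>{..k}. ?f i \<otimes> ?g (k - i))"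
    unfolding term_eq[symmetric]
    using deg_mult_ring[OF p q] by (intro eval_eq_finsum) (auto simp: n_def m_def p q a)
  also have "\<dots> = (\<Oplus>i\<in>{..n}. ?f i) \<otimes> (\<Oplus>i\<in>{..m}. ?g i)"
    using a p q by (intro R.cauchy_product) (auto simp: bound_def n_def m_def deg_aboveD)
  also have "\<dots> = eval R R id a p \<otimes> eval R R id a q"
    unfolding n_def m_def eval_eq_finsum[OF p a order_refl] eval_eq_finsum[OF q a order_refl] ..
  finally show ?thesis .
qed

lemma eval_mult_pow_commuting:
  assumes p: "p \<in> carrier P" and q: "q \<in> carrier P" and a: "a \<in> carrier R"
    and comm: "\<And>i. coeff P q i \<otimes> a = a \<otimes> coeff P q i"
  shows "eval R R id a (p \<otimes>\<^bsub>P\<^esub> q [^]\<^bsub>P\<^esub> k) = eval R R id a p \<otimes> (eval R R id a q) [^] (k::nat)"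
proof (induction k)
  case 0
  then show ?case using R.r_one[OF eval_closed[OF p a]] p by (simp del: id_apply R.r_one)
next
  case (Suc k)
  have "eval R R id a (p \<otimes>\<^bsub>P\<^esub> q [^]\<^bsub>P\<^esub> Suc k)
      = eval R R id a (p \<otimes>\<^bsub>P\<^esub> q [^]\<^bsub>P\<^esub> k \<otimes>\<^bsub>P\<^esub> q)"
    using p q by (simp add: P.m_assoc)
  then show ?case
    using Suc eval_mult_commuting[OF _ q a comm, of "p \<otimes>\<^bsub>P\<^esub> q [^]\<^bsub>P\<^esub> k"] p q a
    by (simp add: R.m_assoc eval_closed del: id_apply)
qed

text \<open>All coefficients of \<open>X\<close> and \<open>X + 1\<close> are \<open>0\<close> or \<open>1\<close>, so they commute with every \<open>a\<close>.\<close>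

lemma eval_mult_X_pow_X1_pow:
  assumes p: "p \<in> carrier P" and a: "a \<in> carrier R"
  shows "eval R R id a (p \<otimes>\<^bsub>P\<^esub> monom P \<one> 1 [^]\<^bsub>P\<^esub> (k::nat)
           \<otimes>\<^bsub>P\<^esub> (monom P \<one> 1 \<oplus>\<^bsub>P\<^esub> \<one>\<^bsub>P\<^esub>) [^]\<^bsub>P\<^esub> (m::nat))
       = eval R R id a p \<otimes> a [^] k \<otimes> (a \<oplus> \<one>) [^] m"
proof -
  let ?X = "monom P \<one> 1"
  have X: "eval R R id a ?X = a"
    using eval_monom[OF R.one_closed a, of 1] a by simp
  have "eval R R id a (?X \<oplus>\<^bsub>P\<^esub> \<one>\<^bsub>P\<^esub>) = a \<oplus> \<one>"
    using eval_add[of ?X "\<one>\<^bsub>P\<^esub>" a] eval_monom[OF R.one_closed a, of 0] a X by simp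
  then show ?thesis
    using p a by (simp add: eval_mult_pow_commuting X[simplified])
qed

end


section \<open>Powers of triangular matrices\<close>

lemma index_mult_mat_sum:
  fixes A B :: "'a :: semiring_0 mat"
  assumes "A \<in> carrier_mat n n" "B \<in> carrier_mat n n" "i < n" "j < n"
  shows "(A * B) $$ (i, j) = (\<Sum>l<n. A $$ (i, l) * B $$ (l, j))"
  using assms by (simp add: scalar_prod_def atLeast0LessThan)

text \<open>A nonzero entry of a power needs a chain of nonzero entries, and the weight rises by at least
  one along each link.\<close>

lemma pow_mat_weight:
  fixes B :: "'a :: semiring_1 mat" and w :: "nat \<Rightarrow> nat"
  assumes B: "B \<in> carrier_mat n n"
    and w: "\<And>i j. i < n \<Longrightarrow> j < n \<Longrightarrow> B $$ (i, j) \<noteq> 0 \<Longrightarrow> w i < w j"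
    and "i < n" "j < n" "(B ^\<^sub>m m) $$ (i, j) \<noteq> 0"
  shows "w i + m \<le> w j"
  using assms(3-)
proof (induction m arbitrary: j)
  case 0
  then show ?case using B by (auto split: if_splits)
next
  case (Suc m)
  have C: "B ^\<^sub>m m \<in> carrier_mat n n" using B by simp
  have "(B ^\<^sub>m Suc m) $$ (i, j) = (\<Sum>l<n. (B ^\<^sub>m m) $$ (i, l) * B $$ (l, j))"
    using index_mult_mat_sum[OF C B] Suc.prems by simp
  with Suc.prems obtain l where "l < n" "(B ^\<^sub>m m) $$ (i, l) * B $$ (l, j) \<noteq> 0"
    by (metis (no_types, lifting) lessThan_iff sum.neutral)
  moreover from this have "(B ^\<^sub>m m) $$ (i, l) \<noteq> 0" "B $$ (l, j) \<noteq> 0" by auto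
  ultimately have "w i + m \<le> w l" "w l < w j"
    using Suc.IH[of l] Suc.prems w[of l j] by auto
  then show ?case by simp
qed

lemma pow_mat_weight_eq_0:
  fixes B :: "'a :: semiring_1 mat" and w :: "nat \<Rightarrow> nat"
  assumes B: "B \<in> carrier_mat n n"
    and w: "\<And>i j. i < n \<Longrightarrow> j < n \<Longrightarrow> B $$ (i, j) \<noteq> 0 \<Longrightarrow> w i < w j"
    and m: "\<And>j. j < n \<Longrightarrow> w j < m"
  shows "B ^\<^sub>m m = 0\<^sub>m n n"
proof (rule eq_matI)
  fix i j assume "i < dim_row (0\<^sub>m n n :: 'a mat)" "j < dim_col (0\<^sub>m n n :: 'a mat)"
  then have ij: "i < n" "j < n" by simp_all
  then show "(B ^\<^sub>m m) $$ (i, j) = 0\<^sub>m n n $$ (i, j)"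
    using pow_mat_weight[OF B w ij(1) ij(2)] m[OF ij(2)] ij by fastforce
qed (use B in auto)

text \<open>Only one chain contributes: \<open>m\<close> strictly increasing steps from \<open>i\<close> to \<open>i + m\<close> have to be
  unit steps.\<close>

lemma pow_mat_strict_upper_entry:
  fixes A :: "'a :: comm_semiring_1 mat"
  assumes A: "A \<in> carrier_mat n n"
    and up: "\<And>i j. i < n \<Longrightarrow> j < n \<Longrightarrow> A $$ (i, j) \<noteq> 0 \<Longrightarrow> i < j"
    and "i + m < n"
  shows "(A ^\<^sub>m m) $$ (i, i + m) = (\<Prod>l\<in>{i..<i + m}. A $$ (l, Suc l))"
  using assms(3)
proof (induction m)
  case 0
  then show ?case using A by simp
next
  case (Suc m)
  have C: "A ^\<^sub>m m \<in> carrier_mat n n" using A by simp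
  have "(A ^\<^sub>m Suc m) $$ (i, i + Suc m) = (\<Sum>l<n. (A ^\<^sub>m m) $$ (i, l) * A $$ (l, i + Suc m))"
    using index_mult_mat_sum[OF C A] Suc.prems by simp
  also have "\<dots> = (\<Sum>l\<in>{i + m}. (A ^\<^sub>m m) $$ (i, l) * A $$ (l, i + Suc m))"
  proof (intro sum.mono_neutral_right ballI)
    fix l assume l: "l \<in> {..<n} - {i + m}"
    show "(A ^\<^sub>m m) $$ (i, l) * A $$ (l, i + Suc m) = 0"
    proof (rule ccontr)
      assume "(A ^\<^sub>m m) $$ (i, l) * A $$ (l, i + Suc m) \<noteq> 0"
      then have "(A ^\<^sub>m m) $$ (i, l) \<noteq> 0" "A $$ (l, i + Suc m) \<noteq> 0" by auto
      then show False
        using pow_mat_weight[where w = "\<lambda>i. i" and i = i and j = l and m = m, OF A up]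
          up[of l "i + Suc m"] l Suc.prems by simp
    qed
  qed (use Suc.prems in auto)
  finally show ?case using Suc by (simp add: mult.commute)
qed


section \<open>Annihilation by powers in the block triangular ring\<close>

lemma Rn_simps:
  "carrier (Rn n) = Rn_set n" "A \<otimes>\<^bsub>Rn n\<^esub> B = A * B" "A \<oplus>\<^bsub>Rn n\<^esub> B = A + B"
  "\<zero>\<^bsub>Rn n\<^esub> = 0\<^sub>m n n" "\<one>\<^bsub>Rn n\<^esub> = 1\<^sub>m n"
  by (simp_all add: Rn_def ring_mat_simps)

lemma Rn_pow:
  assumes "n \<ge> 2" "A \<in> Rn_set n"
  shows "A [^]\<^bsub>Rn n\<^esub> (k::nat) = A ^\<^sub>m k"
proof -
  interpret M: ring "ring_mat TYPE(bit) n ()" by (rule ring_mat)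
  have "A \<in> carrier_mat n n"
    using assms Rn_set_iff by (auto simp: Rn_entries_def)
  then show ?thesis
    unfolding Rn_def M.nat_pow_consistent[symmetric] by (rule pow_mat_ring_pow[symmetric])
qed

text \<open>In odd size the last row and column lie outside the \<open>2\<close> by \<open>2\<close> blocks.  Both matrices below
  are zero there; for \<open>block_e11\<close> this is forced, because the last diagonal entry repeats the
  lower right entry of the diagonal block.\<close>

definition block_e12 :: "nat \<Rightarrow> bit mat" where
  "block_e12 n = mat n n (\<lambda>(i, j). if even i \<and> j = Suc i then 1 else 0)"

definition block_e11 :: "nat \<Rightarrow> bit mat" where
  "block_e11 n = mat n n (\<lambda>(i, j). if i = j \<and> diag_repr n i = 0 then 1 else 0)"

definition shift_mat :: "nat \<Rightarrow> bit mat" where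
  "shift_mat n = mat n n (\<lambda>(i, j). if j = Suc i then 1 else 0)"

lemma special_in_Rn_set:
  assumes "n \<ge> 2"
  shows "block_e12 n \<in> Rn_set n" "block_e11 n \<in> Rn_set n" "shift_mat n \<in> Rn_set n"
  using assms
  by (auto simp: Rn_set_iff Rn_entries_def block_e12_def block_e11_def shift_mat_def diag_repr_def)

lemma block_e12_mult_block_e11: "block_e12 n * block_e11 n = 0\<^sub>m n n"
  by (rule eq_matI)
    (auto simp: block_e12_def block_e11_def diag_repr_def scalar_prod_def intro!: sum.neutral)

text \<open>In a nonzero summand \<open>(U + A) $$ (i, l) * C $$ (l, j)\<close> with \<open>C = A ^\<^sub>m (n - 2)\<close>, strict
  triangularity gives \<open>i < l\<close> and \<open>l + (n - 2) \<le> j\<close>.  This leaves only \<open>i = 0\<close>, \<open>l = 1\<close>,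
  \<open>j = n - 1\<close>, where \<open>U $$ (0, 1) = 1\<close> and the summand is \<open>(1 + b) * C $$ (1, n - 1)\<close> with
  \<open>b = A $$ (0, 1)\<close>.\<close>

lemma Rn_entries_nilpotent:
  assumes n: "n \<ge> 4" and A: "Rn_entries n A" and diag: "A $$ (0, 0) = 0" "A $$ (1, 1) = 0"
  shows "(block_e12 n + A) * A ^\<^sub>m (n - 2) = 0\<^sub>m n n"
proof -
  let ?C = "A ^\<^sub>m (n - 2)" and ?U = "block_e12 n"
  have cA: "A \<in> carrier_mat n n" and cU: "?U \<in> carrier_mat n n"
    using A by (simp_all add: Rn_entries_def block_e12_def)
  have cC: "?C \<in> carrier_mat n n" using cA by simp
  have d: "A $$ (i, i) = 0" if "i < n" for i
    using Rn_entriesD(2)[OF A that] diag by (auto simp: diag_repr_def split: if_splits)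
  have up: "i < j" if "i < n" "j < n" "A $$ (i, j) \<noteq> 0" for i j
    using that d Rn_entriesD(1)[OF A, of i j] by (metis linorder_neqE_nat)
  have low: "l + (n - 2) \<le> j" if "l < n" "j < n" "?C $$ (l, j) \<noteq> 0" for l j
    using pow_mat_weight[where w = "\<lambda>i. i", OF cA up that] by simp
  \<comment> \<open>The superdiagonal entry in row \<open>2\<close> belongs to the second diagonal block, hence equals
      \<open>A $$ (0, 1)\<close>; it occurs in the product as \<open>n - 2 \<ge> 2\<close>.\<close>
  have key: "(1 + A $$ (0, 1)) * ?C $$ (1, n - 1) = 0"
  proof (cases "A $$ (0, 1) = 0")
    case True
    have "?C $$ (1, 1 + (n - 2)) = (\<Prod>l\<in>{1..<1 + (n - 2)}. A $$ (l, Suc l))"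
      using n by (intro pow_mat_strict_upper_entry[OF cA up]) auto
    also have "\<dots> = 0"
    proof (rule prod_zero)
      have "A $$ (2, Suc 2) = 0" using Rn_entriesD(3)[OF A, of 1] n True by simp
      then show "\<exists>l\<in>{1..<1 + (n - 2)}. A $$ (l, Suc l) = 0"
        using n by (intro bexI[of _ 2]) auto
    qed simp
    finally have "?C $$ (1, n - 1) = 0" using n by (simp add: Suc_diff_Suc numeral_2_eq_2)
    then show ?thesis by simp
  next
    case False
    then show ?thesis by simp
  qed
  have zero: "(?U + A) $$ (i, l) * ?C $$ (l, j) = 0" if "i < n" "j < n" "l < n" for i j l
  proof (rule ccontr)
    assume nz: "(?U + A) $$ (i, l) * ?C $$ (l, j) \<noteq> 0"
    then have "l + (n - 2) \<le> j" using low that by auto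
    moreover have "i < l"
    proof -
      have "(?U + A) $$ (i, l) \<noteq> 0" using nz by auto
      then have "?U $$ (i, l) \<noteq> 0 \<or> A $$ (i, l) \<noteq> 0" using that cA cU by auto
      then show ?thesis using up that by (auto simp: block_e12_def split: if_splits)
    qed
    ultimately have "i = 0" "l = 1" "j = n - 1" using that by auto
    then show False using nz key n cA by (simp add: block_e12_def)
  qed
  show ?thesis
  proof (rule eq_matI)
    fix i j assume "i < dim_row (0\<^sub>m n n :: bit mat)" "j < dim_col (0\<^sub>m n n :: bit mat)"
    then have ij: "i < n" "j < n" by simp_all
    have cUA: "?U + A \<in> carrier_mat n n" using cU cA by simp
    have "((?U + A) * ?C) $$ (i, j) = (\<Sum>l<n. (?U + A) $$ (i, l) * ?C $$ (l, j))"
      by (rule index_mult_mat_sum[OF cUA cC ij])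
    also have "\<dots> = 0" by (rule sum.neutral) (use zero ij in blast)
    finally show "((?U + A) * ?C) $$ (i, j) = 0\<^sub>m n n $$ (i, j)" using ij by simp
  qed (use cA cU in auto)
qed

lemma Rn_entries_unipotent:
  assumes n: "n \<ge> 2" and A: "Rn_entries n A" and diag: "A $$ (0, 0) = 1" "A $$ (1, 1) = 1"
  shows "(A + 1\<^sub>m n) ^\<^sub>m n = 0\<^sub>m n n"
proof (rule pow_mat_weight_eq_0[where w = id])
  have cA: "A \<in> carrier_mat n n" using A by (simp add: Rn_entries_def)
  then show "A + 1\<^sub>m n \<in> carrier_mat n n" by simp
  have d: "A $$ (i, i) = 1" if "i < n" for i
    using Rn_entriesD(2)[OF A that] diag by (auto simp: diag_repr_def split: if_splits)
  show "id i < id j" if "i < n" "j < n" "(A + 1\<^sub>m n) $$ (i, j) \<noteq> 0" for i j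
    using that d cA Rn_entriesD(1)[OF A, of i j]
    by (cases i j rule: linorder_cases) auto
qed simp

text \<open>The common diagonal block has the eigenvalues \<open>0\<close> and \<open>1\<close>, so it is a root of
  \<open>x (x + 1)\<close>, and so is the final diagonal entry in odd size.  Hence every nonzero entry of
  \<open>A (A + 1)\<close> leads from one block to a strictly later one, and the block index serves as the
  weight; it takes at most \<open>n - 2\<close> values when \<open>n \<ge> 4\<close>.\<close>

lemma Rn_entries_mixed:
  assumes n: "n \<ge> 4" and A: "Rn_entries n A" and diag: "A $$ (0, 0) \<noteq> A $$ (1, 1)"
  shows "(A * (A + 1\<^sub>m n)) ^\<^sub>m (n - 2) = 0\<^sub>m n n"
proof (rule pow_mat_weight_eq_0[where w = "\<lambda>i. i div 2"])
  have cA: "A \<in> carrier_mat n n" using A by (simp add: Rn_entries_def)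
  then show cB: "A * (A + 1\<^sub>m n) \<in> carrier_mat n n" by simp
  show "j div 2 < n - 2" if "j < n" for j using that n by auto
  show "i div 2 < j div 2" if ij: "i < n" "j < n" and nz: "(A * (A + 1\<^sub>m n)) $$ (i, j) \<noteq> 0" for i j
  proof (rule ccontr)
    assume le: "\<not> i div 2 < j div 2"
    let ?h = "\<lambda>l. A $$ (i, l) * (A + 1\<^sub>m n) $$ (l, j)"
    have prod: "(A * (A + 1\<^sub>m n)) $$ (i, j) = sum ?h {..<n}"
      using cA ij by (intro index_mult_mat_sum) auto
    have low: "A $$ (r, s) = 0" if "r < n" "s < r" for r s
      using Rn_entriesD(1)[OF A that] .
    have "sum ?h {..<n} = sum ?h {i..j}"
      using ij low cA by (intro sum.mono_neutral_right) (auto simp: not_le)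
    also have "\<dots> = 0"
    proof -
      have "j < i \<or> j = i \<or> j = Suc i \<and> even i"
        using le by presburger
      then consider "j < i" | "j = i" | "j = Suc i" "even i" by blast
      then show ?thesis
      proof cases
        case 2
        then show ?thesis using ij cA by (cases "A $$ (i, i)") auto
      next
        case 3
        then have r: "diag_repr n i = 0" "diag_repr n (Suc i) = 1"
          using ij by (simp_all add: diag_repr_def)
        have "A $$ (i, i) = A $$ (0, 0)" "A $$ (Suc i, Suc i) = A $$ (1, 1)"
          using Rn_entriesD(2)[OF A, of i] Rn_entriesD(2)[OF A, of "Suc i"] r ij 3 by simp_all
        then have "A $$ (i, i) \<noteq> A $$ (Suc i, Suc i)" using diag by simp
        then have "A $$ (i, i) * A $$ (i, Suc i) + A $$ (i, Suc i) * (A $$ (Suc i, Suc i) + 1) = 0"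
          by (cases "A $$ (i, i)"; cases "A $$ (Suc i, Suc i)") auto
        then have "?h i + ?h (Suc i) = 0"
          using 3 ij cA by simp
        moreover have "sum ?h {i, Suc i} = ?h i + ?h (Suc i)"
          by (subst sum.insert) (simp_all only: finite.intros sum.insert sum.empty empty_iff
              insert_iff n_not_Suc_n not_False_eq_True add_0_right simp_thms)
        moreover have "{i..j} = {i, Suc i}" using 3 by auto
        ultimately show ?thesis by (simp only:)
      qed simp
    qed
    finally show False using nz prod by simp
  qed
qed


section \<open>The null ideal\<close>

text \<open>The first two factors of \<open>(U + x) x\<^bsup>n - 2\<^esup> (x + 1)\<^bsup>n\<^esup>\<close> annihilate the nilpotent elements of the
  ring, the third the unipotent ones, and the last two together all remaining ones.\<close>

definition null_poly :: "nat \<Rightarrow> nat \<Rightarrow> bit mat" where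
  "null_poly n =
    (monom (UP (Rn n)) (block_e12 n) 0 \<oplus>\<^bsub>UP (Rn n)\<^esub> monom (UP (Rn n)) \<one>\<^bsub>Rn n\<^esub> 1)
      \<otimes>\<^bsub>UP (Rn n)\<^esub> monom (UP (Rn n)) \<one>\<^bsub>Rn n\<^esub> 1 [^]\<^bsub>UP (Rn n)\<^esub> (n - 2)
      \<otimes>\<^bsub>UP (Rn n)\<^esub> (monom (UP (Rn n)) \<one>\<^bsub>Rn n\<^esub> 1 \<oplus>\<^bsub>UP (Rn n)\<^esub> \<one>\<^bsub>UP (Rn n)\<^esub>) [^]\<^bsub>UP (Rn n)\<^esub> n"

lemma null_poly_in_null_ideal:
  assumes n: "n \<ge> 4"
  shows "null_poly n \<in> null_ideal (Rn n)"
proof -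
  let ?R = "Rn n" and ?U = "block_e12 n"
  have n2: "n \<ge> 2" using n by simp
  interpret UP_ring ?R "UP ?R" by (rule UP_ring.intro[OF ring_Rn[OF n2]])
  have U: "?U \<in> carrier ?R" using special_in_Rn_set[OF n2] by (simp add: Rn_simps)
  have "eval ?R ?R id A (null_poly n) = \<zero>\<^bsub>?R\<^esub>" if A: "A \<in> carrier ?R" for A
  proof -
    have E: "Rn_entries n A" using A Rn_set_iff[OF n2] by (simp add: Rn_simps)
    have pow: "B [^]\<^bsub>?R\<^esub> k = B ^\<^sub>m k" if "B \<in> carrier ?R" for B and k :: nat
      using Rn_pow[OF n2] that by (simp add: Rn_simps)
    have A1: "A \<oplus>\<^bsub>?R\<^esub> \<one>\<^bsub>?R\<^esub> \<in> carrier ?R" using A by simp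
    have "eval ?R ?R id A (null_poly n)
        = (?U \<oplus>\<^bsub>?R\<^esub> A) \<otimes>\<^bsub>?R\<^esub> A [^]\<^bsub>?R\<^esub> (n - 2) \<otimes>\<^bsub>?R\<^esub> (A \<oplus>\<^bsub>?R\<^esub> \<one>\<^bsub>?R\<^esub>) [^]\<^bsub>?R\<^esub> n"
    proof -
      have "eval ?R ?R id A (monom (UP ?R) ?U 0 \<oplus>\<^bsub>UP ?R\<^esub> monom (UP ?R) \<one>\<^bsub>?R\<^esub> 1) = ?U \<oplus>\<^bsub>?R\<^esub> A"
        using U A eval_add[OF monom_closed[OF U] monom_closed[OF R.one_closed] A]
          eval_monom[OF U A] eval_monom[OF R.one_closed A] by simp
      then show ?thesis
        unfolding null_poly_def using U A by (subst eval_mult_X_pow_X1_pow) auto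
    qed
    also have "\<dots> = \<zero>\<^bsub>?R\<^esub>"
    proof -
      consider "A $$ (0, 0) = 0" "A $$ (1, 1) = 0" | "A $$ (0, 0) = 1" "A $$ (1, 1) = 1"
        | "A $$ (0, 0) \<noteq> A $$ (1, 1)"
        by (cases "A $$ (0, 0)"; cases "A $$ (1, 1)") auto
      then show ?thesis
      proof cases
        case 1
        then have "(?U \<oplus>\<^bsub>?R\<^esub> A) \<otimes>\<^bsub>?R\<^esub> A [^]\<^bsub>?R\<^esub> (n - 2) = \<zero>\<^bsub>?R\<^esub>"
          using Rn_entries_nilpotent[OF n E] by (simp add: pow[OF A]) (simp add: Rn_simps)
        then show ?thesis using A by simp
      next
        case 2
        then have "(A \<oplus>\<^bsub>?R\<^esub> \<one>\<^bsub>?R\<^esub>) [^]\<^bsub>?R\<^esub> n = \<zero>\<^bsub>?R\<^esub>"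
          using Rn_entries_unipotent[OF n2 E] by (simp add: pow[OF A1]) (simp add: Rn_simps)
        then show ?thesis using A U by simp
      next
        case 3
        let ?A1 = "A \<oplus>\<^bsub>?R\<^esub> \<one>\<^bsub>?R\<^esub>"
        have AA1: "A \<otimes>\<^bsub>?R\<^esub> ?A1 \<in> carrier ?R" using A by simp
        have comm: "A \<otimes>\<^bsub>?R\<^esub> ?A1 = ?A1 \<otimes>\<^bsub>?R\<^esub> A"
          using A by (simp add: R.l_distr R.r_distr)
        have "?A1 [^]\<^bsub>?R\<^esub> n = ?A1 [^]\<^bsub>?R\<^esub> (n - 2) \<otimes>\<^bsub>?R\<^esub> ?A1 [^]\<^bsub>?R\<^esub> (2::nat)"
          by (simp only: R.nat_pow_mult[OF A1] le_add_diff_inverse2[OF n2])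
        then have "A [^]\<^bsub>?R\<^esub> (n - 2) \<otimes>\<^bsub>?R\<^esub> ?A1 [^]\<^bsub>?R\<^esub> n
            = (A \<otimes>\<^bsub>?R\<^esub> ?A1) [^]\<^bsub>?R\<^esub> (n - 2) \<otimes>\<^bsub>?R\<^esub> ?A1 [^]\<^bsub>?R\<^esub> (2::nat)"
          using A by (simp add: R.pow_mult_distrib[OF comm] R.m_assoc)
        also have "(A \<otimes>\<^bsub>?R\<^esub> ?A1) [^]\<^bsub>?R\<^esub> (n - 2) = \<zero>\<^bsub>?R\<^esub>"
          using Rn_entries_mixed[OF n E 3] by (simp add: pow[OF AA1]) (simp add: Rn_simps)
        finally show ?thesis using A U by (simp add: R.m_assoc)
      qed
    qed
    finally show ?thesis .
  qed
  moreover have "null_poly n \<in> carrier (UP ?R)" unfolding null_poly_def using U by simp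
  ultimately show ?thesis unfolding null_ideal_def by blast
qed

lemma (in ring) mult_pow_fixed:
  assumes "x \<otimes> y = x" "x \<in> carrier R" "y \<in> carrier R"
  shows "x \<otimes> y [^] (k::nat) = x"
  by (induction k) (use assms in \<open>simp_all flip: m_assoc\<close>)

text \<open>Since \<open>D = block_e11 n\<close> commutes with \<open>x\<close> and \<open>U D = 0\<close>, the product is
  \<open>D x\<^bsup>n - 1\<^esup> (x + 1)\<^bsup>n\<^esup>\<close>.  At the shift matrix \<open>S\<close> the unipotent factor has no effect, because
  \<open>S\<^bsup>n - 1\<^esup> (S + 1) = S\<^bsup>n - 1\<^esup>\<close>, and \<open>D\<close> fixes \<open>S\<^bsup>n - 1\<^esup> \<noteq> 0\<close>, whose only nonzero row is the
  first.\<close>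

lemma null_poly_mult_block_e11_notin_null_ideal:
  assumes n: "n \<ge> 4"
  shows "null_poly n \<otimes>\<^bsub>UP (Rn n)\<^esub> monom (UP (Rn n)) (block_e11 n) 0 \<notin> null_ideal (Rn n)"
proof -
  let ?R = "Rn n" and ?U = "block_e12 n" and ?D = "block_e11 n" and ?S = "shift_mat n"
  let ?P = "UP ?R"
  let ?X = "monom ?P \<one>\<^bsub>?R\<^esub> 1"
  let ?d = "monom ?P ?D 0"
  let ?Y = "?X \<oplus>\<^bsub>?P\<^esub> \<one>\<^bsub>?P\<^esub>"
  have n2: "n \<ge> 2" using n by simp
  interpret UP_ring ?R ?P by (rule UP_ring.intro[OF ring_Rn[OF n2]])
  have U: "?U \<in> carrier ?R" and D: "?D \<in> carrier ?R" and S: "?S \<in> carrier ?R"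
    using special_in_Rn_set[OF n2] by (simp_all add: Rn_simps)
  have pow: "?S [^]\<^bsub>?R\<^esub> k = ?S ^\<^sub>m k" for k :: nat
    using Rn_pow[OF n2] S by (simp add: Rn_simps)
  have Xd: "?X \<otimes>\<^bsub>?P\<^esub> ?d = monom ?P ?D 1" "?d \<otimes>\<^bsub>?P\<^esub> ?X = monom ?P ?D 1"
    using monom_mult[of "\<one>\<^bsub>?R\<^esub>" ?D 1 0] monom_mult[of ?D "\<one>\<^bsub>?R\<^esub>" 0 1] D by simp_all
  have Yd: "?Y \<otimes>\<^bsub>?P\<^esub> ?d = ?d \<otimes>\<^bsub>?P\<^esub> ?Y"
    using D Xd by (simp add: P.l_distr P.r_distr)
  have Xpow: "?X [^]\<^bsub>?P\<^esub> k \<otimes>\<^bsub>?P\<^esub> ?d = ?d \<otimes>\<^bsub>?P\<^esub> ?X [^]\<^bsub>?P\<^esub> k" for k :: nat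
    by (rule P.group_commutes_pow) (use Xd D in simp_all)
  have Ypow: "?Y [^]\<^bsub>?P\<^esub> k \<otimes>\<^bsub>?P\<^esub> ?d = ?d \<otimes>\<^bsub>?P\<^esub> ?Y [^]\<^bsub>?P\<^esub> k" for k :: nat
    by (rule P.group_commutes_pow) (use Yd D in simp_all)
  have UD: "?U \<otimes>\<^bsub>?R\<^esub> ?D = \<zero>\<^bsub>?R\<^esub>" using block_e12_mult_block_e11 by (simp add: Rn_simps)
  then have "monom ?P ?U 0 \<otimes>\<^bsub>?P\<^esub> ?d = \<zero>\<^bsub>?P\<^esub>"
    using monom_mult[OF U D, of 0 0] by simp
  then have head: "(monom ?P ?U 0 \<oplus>\<^bsub>?P\<^esub> ?X) \<otimes>\<^bsub>?P\<^esub> ?d = monom ?P ?D 1"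
    using U D Xd by (simp add: P.l_distr)
  have assoc: "p \<otimes>\<^bsub>?P\<^esub> x \<otimes>\<^bsub>?P\<^esub> y \<otimes>\<^bsub>?P\<^esub> ?d = p \<otimes>\<^bsub>?P\<^esub> ?d \<otimes>\<^bsub>?P\<^esub> x \<otimes>\<^bsub>?P\<^esub> y"
    if "p \<in> carrier ?P" "x \<in> carrier ?P" "y \<in> carrier ?P"
      "x \<otimes>\<^bsub>?P\<^esub> ?d = ?d \<otimes>\<^bsub>?P\<^esub> x" "y \<otimes>\<^bsub>?P\<^esub> ?d = ?d \<otimes>\<^bsub>?P\<^esub> y" for p x y
    using that D by (metis P.m_assoc P.m_closed monom_closed)
  have "null_poly n \<otimes>\<^bsub>?P\<^esub> ?d
      = monom ?P ?D 1 \<otimes>\<^bsub>?P\<^esub> ?X [^]\<^bsub>?P\<^esub> (n - 2) \<otimes>\<^bsub>?P\<^esub> ?Y [^]\<^bsub>?P\<^esub> n"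
    unfolding null_poly_def head[symmetric] using U
    by (intro assoc Xpow Ypow) simp_all
  then have "eval ?R ?R id ?S (null_poly n \<otimes>\<^bsub>?P\<^esub> ?d)
      = ?D \<otimes>\<^bsub>?R\<^esub> ?S \<otimes>\<^bsub>?R\<^esub> ?S [^]\<^bsub>?R\<^esub> (n - 2) \<otimes>\<^bsub>?R\<^esub> (?S \<oplus>\<^bsub>?R\<^esub> \<one>\<^bsub>?R\<^esub>) [^]\<^bsub>?R\<^esub> n"
    using S eval_monom[OF D S, of 1] eval_mult_X_pow_X1_pow[OF monom_closed[OF D] S] by simp
  also have "?D \<otimes>\<^bsub>?R\<^esub> ?S \<otimes>\<^bsub>?R\<^esub> ?S [^]\<^bsub>?R\<^esub> (n - 2) = ?D \<otimes>\<^bsub>?R\<^esub> ?S [^]\<^bsub>?R\<^esub> (n - 1)"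
  proof -
    have "n - 1 = Suc (n - 2)" using n by simp
    then have "?S [^]\<^bsub>?R\<^esub> (n - 1) = ?S \<otimes>\<^bsub>?R\<^esub> ?S [^]\<^bsub>?R\<^esub> (n - 2)"
      using R.nat_pow_Suc2[OF S] by simp
    then show ?thesis using S D by (simp add: R.m_assoc)
  qed
  also have "?D \<otimes>\<^bsub>?R\<^esub> ?S [^]\<^bsub>?R\<^esub> (n - 1) \<otimes>\<^bsub>?R\<^esub> (?S \<oplus>\<^bsub>?R\<^esub> \<one>\<^bsub>?R\<^esub>) [^]\<^bsub>?R\<^esub> n
      = ?D \<otimes>\<^bsub>?R\<^esub> ?S [^]\<^bsub>?R\<^esub> (n - 1)"
  proof (rule R.mult_pow_fixed)
    have "?S ^\<^sub>m n = 0\<^sub>m n n"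
      by (rule pow_mat_weight_eq_0[where w = id]) (auto simp: shift_mat_def split: if_splits)
    moreover have "?S [^]\<^bsub>?R\<^esub> (n - 1) \<otimes>\<^bsub>?R\<^esub> ?S = ?S [^]\<^bsub>?R\<^esub> n"
      using R.nat_pow_Suc[of ?S "n - 1"] n by simp
    ultimately have "?S [^]\<^bsub>?R\<^esub> (n - 1) \<otimes>\<^bsub>?R\<^esub> ?S = \<zero>\<^bsub>?R\<^esub>"
      by (simp add: pow) (simp add: Rn_simps)
    then show "?D \<otimes>\<^bsub>?R\<^esub> ?S [^]\<^bsub>?R\<^esub> (n - 1) \<otimes>\<^bsub>?R\<^esub> (?S \<oplus>\<^bsub>?R\<^esub> \<one>\<^bsub>?R\<^esub>) = ?D \<otimes>\<^bsub>?R\<^esub> ?S [^]\<^bsub>?R\<^esub> (n - 1)"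
      using S D by (simp add: R.r_distr R.m_assoc)
  qed (use S D in simp_all)
  finally have ev: "eval ?R ?R id ?S (null_poly n \<otimes>\<^bsub>?P\<^esub> ?d) = ?D * ?S ^\<^sub>m (n - 1)"
    by (simp only: pow Rn_simps)
  have cS: "?S \<in> carrier_mat n n" and cD: "?D \<in> carrier_mat n n"
    by (simp_all add: shift_mat_def block_e11_def)
  have S_top: "(?S ^\<^sub>m (n - 1)) $$ (0, 0 + (n - 1)) = 1"
    using n by (subst pow_mat_strict_upper_entry[OF cS])
      (auto simp: shift_mat_def split: if_splits intro!: prod.neutral)
  have "(?D * ?S ^\<^sub>m (n - 1)) $$ (0, n - 1) = (\<Sum>l<n. ?D $$ (0, l) * (?S ^\<^sub>m (n - 1)) $$ (l, n - 1))"
    using n cS cD by (intro index_mult_mat_sum) auto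
  also have "\<dots> = (\<Sum>l\<in>{0}. ?D $$ (0, l) * (?S ^\<^sub>m (n - 1)) $$ (l, n - 1))"
    using n by (intro sum.mono_neutral_right) (auto simp: block_e11_def)
  also have "\<dots> = 1" using S_top n by (simp add: block_e11_def diag_repr_def)
  finally have "?D * ?S ^\<^sub>m (n - 1) \<noteq> 0\<^sub>m n n" using n by auto
  then have "eval ?R ?R id ?S (null_poly n \<otimes>\<^bsub>?P\<^esub> ?d) \<noteq> \<zero>\<^bsub>?R\<^esub>"
    unfolding ev by (simp add: Rn_simps)
  then show ?thesis using S unfolding null_ideal_def by blast
qed

theorem theorem5p11:
  fixes n :: nat
  assumes "n \<ge> 4"
  shows "\<not> ideal (null_ideal (Rn n)) (UP (Rn n))"
proof
  assume I: "ideal (null_ideal (Rn n)) (UP (Rn n))"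
  interpret UP_ring "Rn n" "UP (Rn n)"
    using assms by (intro UP_ring.intro ring_Rn) simp
  have "monom (UP (Rn n)) (block_e11 n) 0 \<in> carrier (UP (Rn n))"
    using special_in_Rn_set[of n] assms by (simp add: Rn_simps)
  from ideal.I_r_closed[OF I null_poly_in_null_ideal[OF assms] this]
  show False using null_poly_mult_block_e11_notin_null_ideal[OF assms] by contradiction
qed

end
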